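(* Let $\epsilon\neq0$ be a fixed complex constant. For nonzero complex parameters $\beta_1,\beta_2$ define the map $R(\beta_1,\beta_2):(x,y)\mapsto(p,q)$ by $$(p^1,p^2)=(y^1+P,\;y^2-P),\qquad (q^1,q^2)=(x^1-P,\;x^2+Q),$$ $$P=\Big(\frac1{\beta_1}-\frac1{\beta_2}\Big)\frac{\beta_1\beta_2\,y^2x^1+\epsilon}{\beta_2y^2-\beta_1x^1},\qquad Q=\Big(\frac1{\beta_2}-\frac1{\beta_1}\Big)\frac{\beta_1\beta_2\,x^2(y^2-x^1-x^2)-\epsilon}{\beta_1x^2+\beta_2(y^2-x^1-x^2)}.$$ Then: (a) whenever $u,v,u_{(1)},u_{(2)},v_{(2)},u_{(1,2)},v_{(1,2)}$ satisfy $$u_{(1,2)}=u+\Big(\frac1{\beta_1}-\frac1{\beta_2}\Big)\frac{\beta_1\beta_2(u+v_{(2)})(u_{(1)}-u)-\epsilon}{\beta_2(u+v_{(2)})+\beta_1(u_{(1)}-u)},\qquad v_{(1,2)}=v+\Big(\frac1{\beta_2}-\frac1{\beta_1}\Big)\frac{\beta_1\beta_2(v+u_{(1)})(v_{(2)}-v)-\epsilon}{\beta_1(v+u_{(1)})+\beta_2(v_{(2)}-v)},$$ the quantities $x=(u-u_{(1)},\,v+u_{(1)})$, $y=(u_{(2)}-u,\,u+v_{(2)})$, $p=(u_{(2)}-u_{(1,2)},\,v_{(2)}+u_{(1,2)})$, $q=(u_{(1,2)}-u_{(1)},\,u_{(1)}+v_{(1,2)})$ satisfy $(p,q)=R(\beta_1,\beta_2)(x,y)$;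 (b) $R$ satisfies the parameter-dependent Yang-Baxter relation $$R^{(2,3)}(\beta_2,\beta_3)\,R^{(1,3)}(\beta_1,\beta_3)\,R^{(1,2)}(\beta_1,\beta_2)=R^{(1,2)}(\beta_1,\beta_2)\,R^{(1,3)}(\beta_1,\beta_3)\,R^{(2,3)}(\beta_2,\beta_3).$$
   Context: Here $x=(x^1,x^2)$, etc.; upper indices on $x,y,p,q$ denote components, not powers. All variables are complex scalars; identities are understood for generic values, where all expressions are defined (equalities of rational maps). $R^{(i,j)}$ acts on triples $(x,y,z)$ of elements of $\mathbb{C}^2$ as $R$ on the $i$-th and $j$-th entries (in this order) and as the identity on the remaining entry; products are compositions. Subscripts in parentheses are just names for the (shifted) field values on the vertices of an elementary square. *)

theory Defs
  imports "HOL-Analysis.Analysis"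
begin

type_synonym c2 = "complex \<times> complex"

text \<open>
  Rational maps are represented by partial functions whose domain is exactly the set of points
  at which every denominator occurring in the formula is nonzero; composition of rational maps
  is composition \<open>\<circ>\<^sub>m\<close> of partial functions (the right factor acts first).
\<close>

definition yb_map :: "complex \<Rightarrow> complex \<Rightarrow> complex \<Rightarrow> c2 \<times> c2 \<rightharpoonup> c2 \<times> c2" where
  "yb_map \<epsilon> \<beta>1 \<beta>2 = (\<lambda>((x1, x2), (y1, y2)).
     if \<beta>2 * y2 - \<beta>1 * x1 \<noteq> 0 \<and> \<beta>1 * x2 + \<beta>2 * (y2 - x1 - x2) \<noteq> 0 then
       (let P = (1 / \<beta>1 - 1 / \<beta>2) * ((\<beta>1 * \<beta>2 * y2 * x1 + \<epsilon>) / (\<beta>2 * y2 - \<beta>1 * x1));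
            Q = (1 / \<beta>2 - 1 / \<beta>1) * ((\<beta>1 * \<beta>2 * x2 * (y2 - x1 - x2) - \<epsilon>)
                                        / (\<beta>1 * x2 + \<beta>2 * (y2 - x1 - x2)))
        in Some ((y1 + P, y2 - P), (x1 - P, x2 + Q)))
     else None)"

definition act12 :: "('a \<times> 'a \<rightharpoonup> 'a \<times> 'a) \<Rightarrow> 'a \<times> 'a \<times> 'a \<rightharpoonup> 'a \<times> 'a \<times> 'a" where
  "act12 F = (\<lambda>(x, y, z). map_option (\<lambda>(p, q). (p, q, z)) (F (x, y)))"

definition act13 :: "('a \<times> 'a \<rightharpoonup> 'a \<times> 'a) \<Rightarrow> 'a \<times> 'a \<times> 'a \<rightharpoonup> 'a \<times> 'a \<times> 'a" where
  "act13 F = (\<lambda>(x, y, z). map_option (\<lambda>(p, q). (p, y, q)) (F (x, z)))"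

definition act23 :: "('a \<times> 'a \<rightharpoonup> 'a \<times> 'a) \<Rightarrow> 'a \<times> 'a \<times> 'a \<rightharpoonup> 'a \<times> 'a \<times> 'a" where
  "act23 F = (\<lambda>(x, y, z). map_option (\<lambda>(p, q). (x, p, q)) (F (y, z)))"

text \<open>
  Equality of rational maps: the two sides agree at every point where both are defined, and
  these points form an open dense set, so that the agreement is not vacuous.
\<close>

definition rational_map_eq :: "('a::topological_space \<rightharpoonup> 'b) \<Rightarrow> ('a \<rightharpoonup> 'b) \<Rightarrow> bool" where
  "rational_map_eq f g \<longleftrightarrow>
     open (dom f \<inter> dom g) \<and> closure (dom f \<inter> dom g) = UNIV \<and>
     (\<forall>t \<in> dom f \<inter> dom g. f t = g t)"

end

theory Submission
  imports Defs
begin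

text \<open>
  Part (a) is a substitution.  For the Yang-Baxter relation, put \<open>b\<^sub>i = 1 / \<beta>\<^sub>i\<close> and, to make the two
  equations of the square look alike, replace the field \<open>v\<close> by \<open>s = - v\<close>.  By part (a) every triple
  \<open>(x, y, z)\<close> consists of the edge variables of a path of four vertices \<open>w0, w1, w2, w3\<close>, with
  \<open>w = (u, s)\<close>, and \<open>R\<close> acting on two adjacent edges keeps the outer two of their three vertices
  and moves the middle one.  The Yang-Baxter relation thus becomes a braid relation for moves of
  \<open>w1\<close> and \<open>w2\<close>.

  After the change of sign, one scalar Moebius map \<open>face\<close>, depending only on the component \<open>s\<close> of
  one neighbour and the component \<open>u\<close> of the other, moves both components of the middle vertex.  If
  \<open>p\<close> and \<open>q\<close> are these two numbers and \<open>J\<close> is a symbol with \<open>J * J = - \<epsilon>\<close>, then in the coordinate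
  \<open>a = (w - p) / b2\<close> before and \<open>(w - p) / b1\<close> after the move the map is multiplication of \<open>a + J\<close> by
  \<open>(q - p) + (b1 - b2) * J\<close>, up to a scalar; this is the addition law of the cotangent.  Such maps
  commute and compose by multiplication of these multipliers.  So the move of \<open>w1\<close> on one side of
  the braid relation agrees with the product of its two moves on the other side as soon as one
  multiplier is proportional to the product of two others, which is a single scalar identity
  (lemma \<open>face_cotangent_addition\<close>).  It settles both components of \<open>w1\<close>
  (\<open>face_factorization\<close>), and those of \<open>w2\<close> follow by reading the path backwards, which
  exchanges \<open>b1\<close> with \<open>b3\<close> and \<open>u\<close> with \<open>s\<close> (\<open>flip_braid\<close>).

  It remains to see that the two sides are defined on a common open dense set.  Openness follows
  from continuity.  For density, any point is joined to infinity by the line in the direction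
  \<open>((1, 0), (1, 0), (1, 0))\<close>.  To leading order at infinity \<open>R\<close> acts on this direction as an exchange
  of the two entries with nonzero denominators, so the leading behaviour persists through all
  compositions.  The denominators are rational functions of the parameter of the line and
  do not vanish identically, hence have only finitely many zeros on it
  (\<open>yb_map_asymptotic_line\<close>, \<open>dense_common_domain\<close>).
\<close>

section \<open>The scalar map on the corner of a square\<close>

definition face_den :: "complex \<Rightarrow> complex \<Rightarrow> complex \<Rightarrow> complex \<Rightarrow> complex \<Rightarrow> complex" where
  "face_den b1 b2 p q w = b1 * (w - p) + b2 * (q - w)"

text \<open>
  The value of the field at the corner opposite to \<open>w\<close> in a square whose other two corners carry
  \<open>p\<close> and \<open>q\<close>.
\<close>

definition face :: "complex \<Rightarrow> complex \<Rightarrow> complex \<Rightarrow> complex \<Rightarrow> complex \<Rightarrow> complex \<Rightarrow> complex" where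
  "face \<epsilon> b1 b2 p q w =
     w + (b1 - b2) * (((w - p) * (q - w) - \<epsilon> * b1 * b2) / face_den b1 b2 p q w)"

text \<open>
  The next two lemmas express the symmetry of the square under reflection in the diagonal through \<open>w\<close>.
\<close>

lemma face_den_swap: "face_den b2 b1 q p w = - face_den b1 b2 p q w"
  by (simp add: face_den_def algebra_simps)

lemma face_swap: "face \<epsilon> b2 b1 q p w = face \<epsilon> b1 b2 p q w"
proof -
  have num: "(w - q) * (p - w) - \<epsilon> * b2 * b1 = (w - p) * (q - w) - \<epsilon> * b1 * b2"
    by (simp add: algebra_simps)
  have "(b2 - b1) * (N / - D) = (b1 - b2) * (N / D)" for N D :: complex
    by (cases "D = 0") (simp_all add: field_simps)
  then show ?thesis
    unfolding face_def face_den_swap[of b2 b1] num by simp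
qed

text \<open>
  The quadratic terms in \<open>w\<close> cancel, which makes \<open>face\<close> a Moebius map; this is the multiplication
  by \<open>(q - p) + (b1 - b2) * J\<close> described above.
\<close>

lemma face_moebius:
  assumes "face_den b1 b2 p q w \<noteq> 0"
  shows "(face \<epsilon> b1 b2 p q w - p) * face_den b1 b2 p q w
       = b1 * ((q - p) * (w - p) - \<epsilon> * b2 * (b1 - b2))"
  using assms unfolding face_def
  by (simp add: divide_simps) (simp add: face_den_def algebra_simps)

text \<open>
  With \<open>J * J = - \<epsilon>\<close> the conclusion says that
  \<open>((V - s0) + (b1 - b2) * J) * ((u2 - s0) + (b2 - b3) * J)\<close> is proportional to
  \<open>(U - s0) + (b1 - b3) * J\<close>.  For \<open>\<epsilon> = 0\<close> and nonzero factors it reduces to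
  \<open>(b1 - b3) / (U - s0) = (b1 - b2) / (V - s0) + (b2 - b3) / (u2 - s0)\<close>.  Stated without
  division, it also covers coinciding parameters.
\<close>

lemma face_cotangent_addition:
  fixes \<epsilon> b1 b2 b3 s0 s1 u2 u3 :: complex
  defines "U \<equiv> face \<epsilon> b1 b2 s1 u3 u2"
  defines "W \<equiv> face \<epsilon> b2 b3 s0 u2 s1"
  defines "V \<equiv> face \<epsilon> b1 b3 W u3 u2"
  assumes D: "face_den b1 b2 s1 u3 u2 \<noteq> 0" "face_den b2 b3 s0 u2 s1 \<noteq> 0"
    "face_den b1 b3 W u3 u2 \<noteq> 0"
  shows "(b1 - b3) * ((V - s0) * (u2 - s0) - \<epsilon> * (b1 - b2) * (b2 - b3))
       = (U - s0) * ((V - s0) * (b2 - b3) + (u2 - s0) * (b1 - b2))" (is "?L = ?R")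
proof -
  let ?D = "face_den b1 b2 s1 u3 u2 * face_den b2 b3 s0 u2 s1 * face_den b1 b3 W u3 u2"
  have "?D * (?L - ?R) = 0"
    using face_moebius[OF D(1), of \<epsilon>, folded U_def]
      face_moebius[OF D(2), of \<epsilon>, folded W_def]
      face_moebius[OF D(3), of \<epsilon>, folded V_def]
    unfolding face_den_def by algebra
  then show ?thesis using D by simp
qed

text \<open>
  The number \<open>w\<close> enters the cross-multiplied equation only through its coefficients, each of
  which is a multiple of the identity of \<open>face_cotangent_addition\<close>; therefore \<open>w\<close> is arbitrary, and
  one lemma serves for both components of a vertex.
\<close>

lemma face_factorization:
  fixes \<epsilon> b1 b2 b3 s0 s1 u2 u3 w :: complex
  defines "U \<equiv> face \<epsilon> b1 b2 s1 u3 u2"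
  defines "V \<equiv> face \<epsilon> b1 b3 (face \<epsilon> b2 b3 s0 u2 s1) u3 u2"
  assumes D: "face_den b1 b2 s1 u3 u2 \<noteq> 0" "face_den b2 b3 s0 u2 s1 \<noteq> 0"
    "face_den b1 b3 (face \<epsilon> b2 b3 s0 u2 s1) u3 u2 \<noteq> 0"
  assumes E: "face_den b1 b3 s0 U w \<noteq> 0" "face_den b2 b3 s0 u2 w \<noteq> 0"
    "face_den b1 b2 s0 V (face \<epsilon> b2 b3 s0 u2 w) \<noteq> 0"
  shows "face \<epsilon> b1 b3 s0 U w = face \<epsilon> b1 b2 s0 V (face \<epsilon> b2 b3 s0 u2 w)" (is "?l = ?r")
proof -
  define M where "M = face \<epsilon> b2 b3 s0 u2 w"
  let ?D = "face_den b1 b3 s0 U w * face_den b2 b3 s0 u2 w * face_den b1 b2 s0 V M"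
  have "?D * (?l - ?r) = 0"
    using face_moebius[OF E(1), of \<epsilon>] face_moebius[OF E(2), of \<epsilon>, folded M_def]
      face_moebius[OF E(3), of \<epsilon>, folded M_def]
      face_cotangent_addition[OF D, folded U_def V_def]
    unfolding face_den_def M_def[symmetric] by algebra
  then show ?thesis using E by (simp add: M_def)
qed

section \<open>The Yang-Baxter map in vertex variables\<close>

text \<open>
  A vertex is a pair \<open>(u, s)\<close> with \<open>s = - v\<close>, and the edge variable is the one of part (a) in this
  notation.
\<close>

definition edge :: "c2 \<Rightarrow> c2 \<Rightarrow> c2" where
  "edge = (\<lambda>(u, s) (u', s'). (u - u', u' - s))"

text \<open>
  The arguments of \<open>flip\<close> and \<open>flippable\<close> are the vertex before, the vertex after, and the middle
  vertex that moves.
\<close>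

definition flip :: "complex \<Rightarrow> complex \<Rightarrow> complex \<Rightarrow> c2 \<Rightarrow> c2 \<Rightarrow> c2 \<Rightarrow> c2" where
  "flip \<epsilon> \<beta>1 \<beta>2 = (\<lambda>(u0, s0) (u2, s2).
     map_prod (face \<epsilon> (1 / \<beta>1) (1 / \<beta>2) s0 u2) (face \<epsilon> (1 / \<beta>1) (1 / \<beta>2) s0 u2))"

definition flippable :: "complex \<Rightarrow> complex \<Rightarrow> c2 \<Rightarrow> c2 \<Rightarrow> c2 \<Rightarrow> bool" where
  "flippable \<beta>1 \<beta>2 = (\<lambda>(u0, s0) (u2, s2) (u1, s1).
     face_den (1 / \<beta>1) (1 / \<beta>2) s0 u2 u1 \<noteq> 0 \<and> face_den (1 / \<beta>1) (1 / \<beta>2) s0 u2 s1 \<noteq> 0)"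

lemma yb_map_edge:
  assumes "\<beta>1 \<noteq> 0" "\<beta>2 \<noteq> 0"
  shows "yb_map \<epsilon> \<beta>1 \<beta>2 (edge w1 w2, edge w0 w1) =
    (if flippable \<beta>1 \<beta>2 w0 w2 w1
     then Some (edge w0 (flip \<epsilon> \<beta>1 \<beta>2 w0 w2 w1), edge (flip \<epsilon> \<beta>1 \<beta>2 w0 w2 w1) w2) else None)"
proof -
  obtain u0 s0 u1 s1 u2 s2 where w: "w0 = (u0, s0)" "w1 = (u1, s1)" "w2 = (u2, s2)"
    by (metis surj_pair)
  define f where "f = face_den (1 / \<beta>1) (1 / \<beta>2) s0 u2"
  have den1: "\<beta>2 * (u1 - s0) - \<beta>1 * (u1 - u2) = \<beta>1 * \<beta>2 * f u1"
    and den2: "\<beta>1 * (u2 - s1) + \<beta>2 * (u1 - s0 - (u1 - u2) - (u2 - s1)) = \<beta>1 * \<beta>2 * f s1"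
    using assms by (simp_all add: f_def face_den_def field_simps)
  have P: "(1 / \<beta>1 - 1 / \<beta>2) * ((\<beta>1 * \<beta>2 * (u1 - s0) * (u1 - u2) + \<epsilon>) / (\<beta>1 * \<beta>2 * f u1))
      = u1 - face \<epsilon> (1 / \<beta>1) (1 / \<beta>2) s0 u2 u1" if "f u1 \<noteq> 0"
    using assms that unfolding face_def f_def[symmetric]
    by (simp add: divide_simps) (simp add: algebra_simps)
  have Q: "(1 / \<beta>2 - 1 / \<beta>1) *
        ((\<beta>1 * \<beta>2 * (u2 - s1) * (u1 - s0 - (u1 - u2) - (u2 - s1)) - \<epsilon>) / (\<beta>1 * \<beta>2 * f s1))
      = s1 - face \<epsilon> (1 / \<beta>1) (1 / \<beta>2) s0 u2 s1" if "f s1 \<noteq> 0"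
    using assms that unfolding face_def f_def[symmetric]
    by (simp add: divide_simps) (simp add: algebra_simps)
  show ?thesis
  proof (cases "f u1 \<noteq> 0 \<and> f s1 \<noteq> 0")
    case True
    then show ?thesis
      using assms unfolding w yb_map_def edge_def flip_def flippable_def Let_def prod.case
        f_def[symmetric] den1 den2 P[OF conjunct1[OF True]] Q[OF conjunct2[OF True]]
      by simp
  next
    case False
    then show ?thesis
      using assms unfolding w yb_map_def edge_def flip_def flippable_def Let_def prod.case
        f_def[symmetric] den1 den2
      by auto
  qed
qed

text \<open>
  The names \<open>l\<close> and \<open>r\<close> refer to the positions of \<open>w1\<close> and \<open>w2\<close> during the moves on the left and on the
  right of the relation: \<open>w2, w1, w2\<close> against \<open>w1, w2, w1\<close>.
\<close>

lemma flip_braid: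
  fixes \<epsilon> \<beta>1 \<beta>2 \<beta>3 :: complex and w0 w1 w2 w3 :: c2
  defines "l2 \<equiv> flip \<epsilon> \<beta>1 \<beta>2 w1 w3 w2"
  defines "l1 \<equiv> flip \<epsilon> \<beta>1 \<beta>3 w0 l2 w1"
  defines "r1 \<equiv> flip \<epsilon> \<beta>2 \<beta>3 w0 w2 w1"
  defines "r2 \<equiv> flip \<epsilon> \<beta>1 \<beta>3 r1 w3 w2"
  assumes L: "flippable \<beta>1 \<beta>2 w1 w3 w2" "flippable \<beta>1 \<beta>3 w0 l2 w1" "flippable \<beta>2 \<beta>3 l1 w3 l2"
  assumes R: "flippable \<beta>2 \<beta>3 w0 w2 w1" "flippable \<beta>1 \<beta>3 r1 w3 w2" "flippable \<beta>1 \<beta>2 w0 r2 r1"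
  shows "l1 = flip \<epsilon> \<beta>1 \<beta>2 w0 r2 r1" and "flip \<epsilon> \<beta>2 \<beta>3 l1 w3 l2 = r2"
proof -
  obtain u0 s0 u1 s1 u2 s2 u3 s3
    where w: "w0 = (u0, s0)" "w1 = (u1, s1)" "w2 = (u2, s2)" "w3 = (u3, s3)"
    by (metis surj_pair)
  define b1 b2 b3 where b: "b1 = 1 / \<beta>1" "b2 = 1 / \<beta>2" "b3 = 1 / \<beta>3"
  note defs = l1_def l2_def r1_def r2_def flip_def flippable_def w b[symmetric] map_prod_simp prod.case
  show "l1 = flip \<epsilon> \<beta>1 \<beta>2 w0 r2 r1"
    using L R unfolding defs
    by (auto intro!: face_factorization)
  \<comment> \<open>Reading the path backwards turns one side of the relation into the other, so the moves of \<open>w2\<close>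
    are those of \<open>w1\<close> for \<open>b3, b2, b1\<close> and the reversed path.\<close>
  have swap: "face_den b2 b1 q p w \<noteq> 0 \<longleftrightarrow> face_den b1 b2 p q w \<noteq> 0" for b1 b2 p q w
    by (simp add: face_den_swap[of b2 b1])
  have "face \<epsilon> b3 b1 u3 (face \<epsilon> b3 b2 u2 s0 s1) t
      = face \<epsilon> b3 b2 u3 (face \<epsilon> b3 b1 (face \<epsilon> b2 b1 u3 s1 u2) s0 s1) (face \<epsilon> b2 b1 u3 s1 t)"
    if "t = u2 \<or> t = s2" for t
    using L R that unfolding defs
    by (intro face_factorization) (auto simp: face_swap[of _ b3 b1] face_swap[of _ b2 b1] face_swap[of _ b3 b2] 
         swap[of b3 b1] swap[of b2 b1] swap[of b3 b2])
  then show "flip \<epsilon> \<beta>2 \<beta>3 l1 w3 l2 = r2"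
    unfolding defs by (simp add: face_swap[of _ b3 b1] face_swap[of _ b2 b1] face_swap[of _ b3 b2])
qed

lemma act12_edge:
  assumes "\<beta>1 \<noteq> 0" "\<beta>2 \<noteq> 0"
  shows "act12 (yb_map \<epsilon> \<beta>1 \<beta>2) (edge w1 w2, edge w0 w1, t) =
    (if flippable \<beta>1 \<beta>2 w0 w2 w1
     then Some (edge w0 (flip \<epsilon> \<beta>1 \<beta>2 w0 w2 w1), edge (flip \<epsilon> \<beta>1 \<beta>2 w0 w2 w1) w2, t) else None)"
  by (simp add: act12_def yb_map_edge[OF assms])

lemma act13_edge:
  assumes "\<beta>1 \<noteq> 0" "\<beta>2 \<noteq> 0"
  shows "act13 (yb_map \<epsilon> \<beta>1 \<beta>2) (edge w1 w2, t, edge w0 w1) =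
    (if flippable \<beta>1 \<beta>2 w0 w2 w1
     then Some (edge w0 (flip \<epsilon> \<beta>1 \<beta>2 w0 w2 w1), t, edge (flip \<epsilon> \<beta>1 \<beta>2 w0 w2 w1) w2) else None)"
  by (simp add: act13_def yb_map_edge[OF assms])

lemma act23_edge:
  assumes "\<beta>1 \<noteq> 0" "\<beta>2 \<noteq> 0"
  shows "act23 (yb_map \<epsilon> \<beta>1 \<beta>2) (t, edge w1 w2, edge w0 w1) =
    (if flippable \<beta>1 \<beta>2 w0 w2 w1
     then Some (t, edge w0 (flip \<epsilon> \<beta>1 \<beta>2 w0 w2 w1), edge (flip \<epsilon> \<beta>1 \<beta>2 w0 w2 w1) w2) else None)"
  by (simp add: act23_def yb_map_edge[OF assms])

text \<open>
  Four vertices have eight components and three edges only six; the choice \<open>w3 = (0, 0)\<close> fixes the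
  freedom of adding a constant to all \<open>u\<close> and \<open>s\<close> and of choosing the last \<open>s\<close>.
\<close>

lemma triple_as_edges:
  obtains w0 w1 w2 w3 where "t = (edge w2 w3, edge w1 w2, edge w0 w1)"
proof -
  obtain x1 x2 y1 y2 z1 z2 where t: "t = ((x1, x2), (y1, y2), (z1, z2))"
    by (metis surj_pair)
  show thesis
    by (rule that[of "(x1, - x2)" "(0, 0)" "(x1 + y1, x1 - y2)" "(x1 + y1 + z1, x1 + y1 - z2)"])
      (simp add: t edge_def)
qed

lemma yang_baxter_on_common_domain:
  fixes \<epsilon> \<beta>1 \<beta>2 \<beta>3 :: complex
  assumes "\<beta>1 \<noteq> 0" "\<beta>2 \<noteq> 0" "\<beta>3 \<noteq> 0"
  defines "l \<equiv> act23 (yb_map \<epsilon> \<beta>2 \<beta>3) \<circ>\<^sub>m act13 (yb_map \<epsilon> \<beta>1 \<beta>3) \<circ>\<^sub>m act12 (yb_map \<epsilon> \<beta>1 \<beta>2)"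
  defines "r \<equiv> act12 (yb_map \<epsilon> \<beta>1 \<beta>2) \<circ>\<^sub>m act13 (yb_map \<epsilon> \<beta>1 \<beta>3) \<circ>\<^sub>m act23 (yb_map \<epsilon> \<beta>2 \<beta>3)"
  assumes "t \<in> dom l \<inter> dom r"
  shows "l t = r t"
proof -
  obtain w0 w1 w2 w3 where t: "t = (edge w2 w3, edge w1 w2, edge w0 w1)"
    by (rule triple_as_edges)
  note acts = act12_edge act13_edge act23_edge
  define l2 where "l2 = flip \<epsilon> \<beta>1 \<beta>2 w1 w3 w2"
  define l1 where "l1 = flip \<epsilon> \<beta>1 \<beta>3 w0 l2 w1"
  define r1 where "r1 = flip \<epsilon> \<beta>2 \<beta>3 w0 w2 w1"
  define r2 where "r2 = flip \<epsilon> \<beta>1 \<beta>3 r1 w3 w2"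
  have l: "l t = (if flippable \<beta>1 \<beta>2 w1 w3 w2 \<and> flippable \<beta>1 \<beta>3 w0 l2 w1 \<and> flippable \<beta>2 \<beta>3 l1 w3 l2
      then Some (edge w0 l1, edge l1 (flip \<epsilon> \<beta>2 \<beta>3 l1 w3 l2), edge (flip \<epsilon> \<beta>2 \<beta>3 l1 w3 l2) w3)
      else None)"
    unfolding l_def t l1_def l2_def by (simp add: map_comp_def acts assms(1-3))
  have r: "r t = (if flippable \<beta>2 \<beta>3 w0 w2 w1 \<and> flippable \<beta>1 \<beta>3 r1 w3 w2 \<and> flippable \<beta>1 \<beta>2 w0 r2 r1
      then Some (edge w0 (flip \<epsilon> \<beta>1 \<beta>2 w0 r2 r1), edge (flip \<epsilon> \<beta>1 \<beta>2 w0 r2 r1) r2, edge r2 w3)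
      else None)"
    unfolding r_def t r1_def r2_def by (simp add: map_comp_def acts assms(1-3))
  have L: "flippable \<beta>1 \<beta>2 w1 w3 w2" "flippable \<beta>1 \<beta>3 w0 l2 w1" "flippable \<beta>2 \<beta>3 l1 w3 l2"
    using \<open>t \<in> dom l \<inter> dom r\<close> l by (auto split: if_splits)
  have R: "flippable \<beta>2 \<beta>3 w0 w2 w1" "flippable \<beta>1 \<beta>3 r1 w3 w2" "flippable \<beta>1 \<beta>2 w0 r2 r1"
    using \<open>t \<in> dom l \<inter> dom r\<close> r by (auto split: if_splits)
  note braid = flip_braid[of \<beta>1 \<beta>2 w1 w3 w2 \<beta>3 w0 \<epsilon>,
      folded l2_def r1_def, folded l1_def r2_def, OF L R]
  show ?thesis
    unfolding l r using L R braid by simp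
qed

section \<open>Openness of the common domain\<close>

definition continuous_open_map :: "('a::topological_space \<rightharpoonup> 'b::topological_space) \<Rightarrow> bool" where
  "continuous_open_map F \<longleftrightarrow> open (dom F) \<and> continuous_on (dom F) (\<lambda>x. the (F x))"

lemma continuous_open_map_comp:
  assumes "continuous_open_map F" "continuous_open_map G"
  shows "continuous_open_map (G \<circ>\<^sub>m F)"
proof -
  let ?f = "\<lambda>x. the (F x)" and ?g = "\<lambda>y. the (G y)"
  let ?D = "dom F \<inter> ?f -` dom G"
  have F: "open (dom F)" "continuous_on (dom F) ?f" and G: "open (dom G)" "continuous_on (dom G) ?g"
    using assms by (simp_all add: continuous_open_map_def)
  have dom: "dom (G \<circ>\<^sub>m F) = ?D"
    by (auto simp: map_comp_def split: option.splits)
  have "continuous_on ?D ?f"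
    using F(2) by (rule continuous_on_subset) simp
  then have "continuous_on ?D (\<lambda>x. ?g (?f x))"
    by (rule continuous_on_compose2[OF G(2)]) auto
  then have "continuous_on ?D (\<lambda>x. the ((G \<circ>\<^sub>m F) x))"
    by (rule continuous_on_eq) (auto simp: map_comp_def)
  moreover have "open ?D"
    using F G(1) by (intro continuous_open_preimage)
  ultimately show ?thesis
    by (simp add: continuous_open_map_def dom)
qed

text \<open>
  The common pattern of the three actions on triples: \<open>i\<close> selects the entries fed to \<open>F\<close>, and \<open>j\<close> puts
  the result back among the others.
\<close>

lemma continuous_open_map_extend:
  fixes F :: "'a::topological_space \<rightharpoonup> 'b::topological_space"
    and i :: "'c::topological_space \<Rightarrow> 'a" and j :: "'b \<times> 'c \<Rightarrow> 'd::topological_space"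
  assumes F: "continuous_open_map F" and i: "continuous_on UNIV i" and j: "continuous_on UNIV j"
  shows "continuous_open_map (\<lambda>x. map_option (\<lambda>y. j (y, x)) (F (i x)))" (is "continuous_open_map ?G")
proof -
  have dom: "dom ?G = i -` dom F"
    by auto
  have "continuous_on (i -` dom F) i"
    using i by (rule continuous_on_subset) simp
  then have "continuous_on (i -` dom F) (\<lambda>x. the (F (i x)))"
    using F unfolding continuous_open_map_def
    by (elim conjE) (rule continuous_on_compose2[of "dom F" "\<lambda>x. the (F x)"], auto)
  then have "continuous_on (i -` dom F) (\<lambda>x. j (the (F (i x)), x))"
    by (intro continuous_on_compose2[OF j] continuous_on_Pair continuous_on_id) auto
  then have "continuous_on (i -` dom F) (\<lambda>x. the (?G x))"
    by (rule continuous_on_eq) auto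
  moreover have "open (i -` dom F)"
    using F i unfolding continuous_open_map_def by (simp add: open_vimage)
  ultimately show ?thesis
    by (simp add: continuous_open_map_def dom)
qed

lemma continuous_open_map_act:
  assumes "continuous_open_map F"
  shows "continuous_open_map (act12 F)" "continuous_open_map (act13 F)" "continuous_open_map (act23 F)"
proof -
  have "continuous_open_map (\<lambda>(x, y, z). map_option (\<lambda>p. (fst p, snd p, z)) (F (x, y)))"
    using continuous_open_map_extend[OF assms, of "\<lambda>(x, y, z). (x, y)" "\<lambda>(p, x, y, z). (fst p, snd p, z)"]
    by (simp add: case_prod_beta' continuous_on_Pair continuous_on_fst continuous_on_snd continuous_on_id)
  then show "continuous_open_map (act12 F)"
    by (simp add: act12_def case_prod_beta')
  have "continuous_open_map (\<lambda>(x, y, z). map_option (\<lambda>p. (fst p, y, snd p)) (F (x, z)))"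
    using continuous_open_map_extend[OF assms, of "\<lambda>(x, y, z). (x, z)" "\<lambda>(p, x, y, z). (fst p, y, snd p)"]
    by (simp add: case_prod_beta' continuous_on_Pair continuous_on_fst continuous_on_snd continuous_on_id)
  then show "continuous_open_map (act13 F)"
    by (simp add: act13_def case_prod_beta')
  have "continuous_open_map (\<lambda>(x, y, z). map_option (\<lambda>p. (x, fst p, snd p)) (F (y, z)))"
    using continuous_open_map_extend[OF assms, of "\<lambda>(x, y, z). (y, z)" "\<lambda>(p, x, y, z). (x, fst p, snd p)"]
    by (simp add: case_prod_beta' continuous_on_Pair continuous_on_fst continuous_on_snd continuous_on_id)
  then show "continuous_open_map (act23 F)"
    by (simp add: act23_def case_prod_beta')
qed

lemma continuous_open_map_yb_map: "continuous_open_map (yb_map \<epsilon> \<beta>1 \<beta>2)"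
proof -
  define d where "d t = \<beta>2 * snd (snd t) - \<beta>1 * fst (fst t)" for t :: "c2 \<times> c2"
  define z where "z t = snd (snd t) - fst (fst t) - snd (fst t)" for t :: "c2 \<times> c2"
  define e where "e t = \<beta>1 * snd (fst t) + \<beta>2 * z t" for t
  define P where "P t = (1 / \<beta>1 - 1 / \<beta>2) * ((\<beta>1 * \<beta>2 * snd (snd t) * fst (fst t) + \<epsilon>) / d t)" for t
  define Q where "Q t = (1 / \<beta>2 - 1 / \<beta>1) * ((\<beta>1 * \<beta>2 * snd (fst t) * z t - \<epsilon>) / e t)" for t
  define g where "g t = ((fst (snd t) + P t, snd (snd t) - P t), (fst (fst t) - P t, snd (fst t) + Q t))" for t
  have yb: "yb_map \<epsilon> \<beta>1 \<beta>2 t = (if d t \<noteq> 0 \<and> e t \<noteq> 0 then Some (g t) else None)" for t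
    unfolding yb_map_def case_prod_beta' Let_def g_def P_def Q_def e_def z_def d_def by (rule refl)
  have dom: "dom (yb_map \<epsilon> \<beta>1 \<beta>2) = {t. d t \<noteq> 0} \<inter> {t. e t \<noteq> 0}"
    by (auto simp: yb split: if_splits)
  have "open (dom (yb_map \<epsilon> \<beta>1 \<beta>2))"
    unfolding dom d_def e_def z_def by (intro open_Int open_Collect_neq continuous_intros)
  moreover have "continuous_on (dom (yb_map \<epsilon> \<beta>1 \<beta>2)) g"
    unfolding dom g_def P_def Q_def d_def e_def z_def by (intro continuous_intros) auto
  then have "continuous_on (dom (yb_map \<epsilon> \<beta>1 \<beta>2)) (\<lambda>t. the (yb_map \<epsilon> \<beta>1 \<beta>2 t))"
    by (rule continuous_on_eq) (auto simp: dom yb)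
  ultimately show ?thesis
    by (simp add: continuous_open_map_def)
qed

section \<open>Density of the common domain\<close>

text \<open>
  The fraction need not represent \<open>g\<close> at the zeros of \<open>q\<close>; this makes the class closed under division,
  by the zero function too, with the convention \<open>x / 0 = 0\<close>.
\<close>

definition rational_fun :: "(complex \<Rightarrow> complex) \<Rightarrow> bool" where
  "rational_fun g \<longleftrightarrow> (\<exists>p q. q \<noteq> 0 \<and> (\<forall>s. poly q s \<noteq> 0 \<longrightarrow> g s = poly p s / poly q s))"

lemma rational_funI:
  assumes "q \<noteq> 0" "\<And>s. poly q s \<noteq> 0 \<Longrightarrow> g s = poly p s / poly q s"
  shows "rational_fun g"
  using assms unfolding rational_fun_def by blast

lemma rational_fun_const: "rational_fun (\<lambda>s. c)"
  by (rule rational_funI[of 1 _ "[:c:]"]) auto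

lemma rational_fun_ident: "rational_fun (\<lambda>s. s)"
  by (rule rational_funI[of 1 _ "[:0, 1:]"]) auto

lemma
  assumes "rational_fun g" "rational_fun h"
  shows rational_fun_add: "rational_fun (\<lambda>s. g s + h s)"
    and rational_fun_diff: "rational_fun (\<lambda>s. g s - h s)"
    and rational_fun_mult: "rational_fun (\<lambda>s. g s * h s)"
    and rational_fun_divide: "rational_fun (\<lambda>s. g s / h s)"
proof -
  obtain q1 p1 where 1: "q1 \<noteq> 0" "\<And>s. poly q1 s \<noteq> 0 \<Longrightarrow> g s = poly p1 s / poly q1 s"
    using assms(1) unfolding rational_fun_def by metis
  obtain q2 p2 where 2: "q2 \<noteq> 0" "\<And>s. poly q2 s \<noteq> 0 \<Longrightarrow> h s = poly p2 s / poly q2 s"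
    using assms(2) unfolding rational_fun_def by metis
  show "rational_fun (\<lambda>s. g s + h s)"
    by (rule rational_funI[of "q1 * q2" _ "p1 * q2 + p2 * q1"]) (auto simp: 1 2 field_simps)
  show "rational_fun (\<lambda>s. g s - h s)"
    by (rule rational_funI[of "q1 * q2" _ "p1 * q2 - p2 * q1"]) (auto simp: 1 2 field_simps)
  show "rational_fun (\<lambda>s. g s * h s)"
    by (rule rational_funI[of "q1 * q2" _ "p1 * p2"]) (auto simp: 1 2)
  show "rational_fun (\<lambda>s. g s / h s)"
  proof (cases "p2 = 0")
    case True
    with 2 show ?thesis
      by (intro rational_funI[of q2 _ 0]) auto
  next
    case False
    then show ?thesis
      by (intro rational_funI[of "q1 * q2 * p2" _ "p1 * q2 * q2"]) (auto simp: 1 2 divide_simps)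
  qed
qed

lemmas rational_fun_intros =
  rational_fun_const rational_fun_ident rational_fun_add rational_fun_diff rational_fun_mult
  rational_fun_divide

definition linear_growth :: "(complex \<Rightarrow> complex) \<Rightarrow> complex \<Rightarrow> bool" where
  "linear_growth g a \<longleftrightarrow> rational_fun g \<and> ((\<lambda>s. g s / s) \<longlongrightarrow> a) at_infinity"

lemma eventually_nonzero_at_infinity: "eventually (\<lambda>s::complex. s \<noteq> 0) at_infinity"
  by (auto simp: eventually_at_infinity intro!: exI[of _ 1])

lemma linear_growth_line: "linear_growth (\<lambda>s. c + s * a) a"
proof -
  have "((\<lambda>s. c / s + a) \<longlongrightarrow> 0 + a) at_infinity"
    by (intro tendsto_intros tendsto_divide_0[OF tendsto_const] filterlim_ident)
  moreover have "eventually (\<lambda>s. c / s + a = (c + s * a) / s) at_infinity"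
    using eventually_nonzero_at_infinity by eventually_elim (simp add: field_simps)
  ultimately have "((\<lambda>s. (c + s * a) / s) \<longlongrightarrow> 0 + a) at_infinity"
    by (rule Lim_transform_eventually)
  then show ?thesis
    unfolding linear_growth_def by (intro conjI rational_fun_intros) simp
qed

lemma linear_growth_add:
  assumes "linear_growth g a" "linear_growth h b"
  shows "linear_growth (\<lambda>s. g s + h s) (a + b)"
  using assms unfolding linear_growth_def add_divide_distrib
  by (intro conjI rational_fun_add tendsto_add) auto

lemma linear_growth_diff:
  assumes "linear_growth g a" "linear_growth h b"
  shows "linear_growth (\<lambda>s. g s - h s) (a - b)"
  using assms unfolding linear_growth_def diff_divide_distrib
  by (intro conjI rational_fun_diff tendsto_diff) auto

lemma linear_growth_cmult:
  assumes "linear_growth g a"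
  shows "linear_growth (\<lambda>s. c * g s) (c * a)"
  using assms unfolding linear_growth_def times_divide_eq_right[symmetric]
  by (intro conjI rational_fun_mult rational_fun_const tendsto_mult_left) auto

text \<open>
  A rational function with infinitely many zeros vanishes off a finite set, which is excluded by its
  growth at infinity.
\<close>

lemma finite_zeros_linear_growth:
  assumes "linear_growth g a" "a \<noteq> 0"
  shows "finite {s. g s = 0}"
proof -
  obtain q p where q: "q \<noteq> 0" and g: "\<And>s. poly q s \<noteq> 0 \<Longrightarrow> g s = poly p s / poly q s"
    using assms(1) unfolding linear_growth_def rational_fun_def by metis
  have "eventually (\<lambda>s. g s / s \<noteq> 0) at_infinity"
    using assms unfolding linear_growth_def by (elim conjE) (rule tendsto_imp_eventually_ne)
  then obtain B where B: "\<And>s. norm s \<ge> B \<Longrightarrow> g s \<noteq> 0"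
    unfolding eventually_at_infinity by auto
  obtain C where C: "\<And>s. poly q s = 0 \<Longrightarrow> norm s \<le> C"
    using finite_imp_bounded[OF poly_roots_finite[OF q]] unfolding bounded_iff by auto
  \<comment> \<open>A point so far out that neither \<open>g\<close> nor the denominator can vanish there.\<close>
  define s0 :: complex where "s0 = of_real (max (max B (C + 1)) 0)"
  have "norm s0 = max (max B (C + 1)) 0"
    by (simp add: s0_def)
  then have "g s0 \<noteq> 0" "poly q s0 \<noteq> 0"
    using B[of s0] C[of s0] by auto
  then have "p \<noteq> 0"
    using g[of s0] by auto
  have "{s. g s = 0} \<subseteq> {s. poly p s = 0} \<union> {s. poly q s = 0}"
    using g by auto
  then show ?thesis
    using poly_roots_finite[OF q] poly_roots_finite[OF \<open>p \<noteq> 0\<close>] by (meson finite_Un finite_subset)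
qed

text \<open>
  This is the shape of the corrections \<open>P\<close> and \<open>Q\<close> of the map \<open>R\<close>: because \<open>a * b = 0\<close>, the product in
  the numerator grows more slowly than quadratically and the quotient is of lower order than linear.
\<close>

lemma linear_growth_quotient:
  assumes "linear_growth g a" "linear_growth h b" "linear_growth d D" "a * b = 0" "D \<noteq> 0"
  shows "linear_growth (\<lambda>s. k * ((m * g s * h s + c) / d s)) 0"
proof -
  have "((\<lambda>s. k * ((m * (g s / s) * (h s / s) + c / s / s) / (d s / s))) \<longlongrightarrow>
      k * ((m * a * b + 0) / D)) at_infinity"
    using assms unfolding linear_growth_def
    by (intro tendsto_intros tendsto_divide_0[OF tendsto_divide_0[OF tendsto_const]] filterlim_ident) auto
  moreover have "eventually (\<lambda>s. k * ((m * (g s / s) * (h s / s) + c / s / s) / (d s / s))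
      = k * ((m * g s * h s + c) / d s) / s) at_infinity"
    using eventually_nonzero_at_infinity
  proof eventually_elim
    case (elim s)
    then show ?case
      by (cases "d s = 0") (simp_all add: field_simps)
  qed
  ultimately have "((\<lambda>s. k * ((m * g s * h s + c) / d s) / s) \<longlongrightarrow> k * ((m * a * b + 0) / D)) at_infinity"
    by (rule Lim_transform_eventually)
  then show ?thesis
    using assms unfolding linear_growth_def
    by (intro conjI rational_fun_intros) (auto simp: mult.assoc)
qed

text \<open>
  The direction \<open>(1, 0)\<close> is chosen such that the leading terms of the products in the numerators of \<open>P\<close>
  and \<open>Q\<close> vanish, while the denominators grow like \<open>- \<beta>1 * s\<close> and \<open>- \<beta>2 * s\<close>, whatever
  the nonzero parameters are.
\<close>

definition asymptotic_line :: "(complex \<Rightarrow> c2) \<Rightarrow> bool" where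
  "asymptotic_line x \<longleftrightarrow> linear_growth (\<lambda>s. fst (x s)) 1 \<and> linear_growth (\<lambda>s. snd (x s)) 0"

lemma yb_map_asymptotic_line:
  assumes "asymptotic_line x" "asymptotic_line y" "\<beta>1 \<noteq> 0" "\<beta>2 \<noteq> 0"
  obtains p q where "asymptotic_line p" "asymptotic_line q"
    "finite {s. yb_map \<epsilon> \<beta>1 \<beta>2 (x s, y s) \<noteq> Some (p s, q s)}"
proof -
  define x1 x2 y1 y2
    where "x1 s = fst (x s)" and "x2 s = snd (x s)" and "y1 s = fst (y s)" and "y2 s = snd (y s)" for s
  note c = x1_def x2_def y1_def y2_def
  have g: "linear_growth x1 1" "linear_growth x2 0" "linear_growth y1 1" "linear_growth y2 0"
    using assms(1,2) by (auto simp: asymptotic_line_def c[abs_def])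
  define d z e where "d s = \<beta>2 * y2 s - \<beta>1 * x1 s" and "z s = y2 s - x1 s - x2 s"
    and "e s = \<beta>1 * x2 s + \<beta>2 * z s" for s
  have z: "linear_growth z (0 - 1 - 0)"
    unfolding z_def by (intro linear_growth_diff g)
  have d: "linear_growth d (\<beta>2 * 0 - \<beta>1 * 1)"
    unfolding d_def by (intro linear_growth_diff linear_growth_cmult g)
  have e: "linear_growth e (\<beta>1 * 0 + \<beta>2 * (0 - 1 - 0))"
    unfolding e_def by (intro linear_growth_add linear_growth_cmult g z)
  define P where "P s = (1 / \<beta>1 - 1 / \<beta>2) * ((\<beta>1 * \<beta>2 * y2 s * x1 s + \<epsilon>) / d s)" for s
  define Q where "Q s = (1 / \<beta>2 - 1 / \<beta>1) * ((\<beta>1 * \<beta>2 * x2 s * z s + (- \<epsilon>)) / e s)" for s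
  have P: "linear_growth P 0"
    unfolding P_def by (rule linear_growth_quotient[OF g(4) g(1) d]) (use assms in auto)
  have Q: "linear_growth Q 0"
    unfolding Q_def by (rule linear_growth_quotient[OF g(2) z e]) (use assms in auto)
  show thesis
  proof (rule that[of "\<lambda>s. (y1 s + P s, y2 s - P s)" "\<lambda>s. (x1 s - P s, x2 s + Q s)"])
    show "asymptotic_line (\<lambda>s. (y1 s + P s, y2 s - P s))"
      using linear_growth_add[OF g(3) P] linear_growth_diff[OF g(4) P] by (simp add: asymptotic_line_def)
    show "asymptotic_line (\<lambda>s. (x1 s - P s, x2 s + Q s))"
      using linear_growth_diff[OF g(1) P] linear_growth_add[OF g(2) Q] by (simp add: asymptotic_line_def)
    have "finite ({s. d s = 0} \<union> {s. e s = 0})"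
      using finite_zeros_linear_growth[OF d] finite_zeros_linear_growth[OF e] assms by simp
    moreover have "yb_map \<epsilon> \<beta>1 \<beta>2 (x s, y s) = Some ((y1 s + P s, y2 s - P s), (x1 s - P s, x2 s + Q s))"
      if "d s \<noteq> 0" "e s \<noteq> 0" for s
      using that by (cases "x s"; cases "y s")
        (simp add: yb_map_def Let_def P_def Q_def d_def e_def z_def c)
    ultimately show "finite {s. yb_map \<epsilon> \<beta>1 \<beta>2 (x s, y s) \<noteq>
        Some ((y1 s + P s, y2 s - P s), (x1 s - P s, x2 s + Q s))}"
      by (elim rev_finite_subset) auto
  qed
qed

definition preserves_asymptotic_lines :: "(c2 \<times> c2 \<times> c2 \<rightharpoonup> c2 \<times> c2 \<times> c2) \<Rightarrow> bool" where
  "preserves_asymptotic_lines F \<longleftrightarrow> (\<forall>x y z. asymptotic_line x \<longrightarrow> asymptotic_line y \<longrightarrow> asymptotic_line z \<longrightarrow>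
     (\<exists>p q r. asymptotic_line p \<and> asymptotic_line q \<and> asymptotic_line r \<and>
        finite {s. F (x s, y s, z s) \<noteq> Some (p s, q s, r s)}))"

lemma preserves_asymptotic_lines_comp:
  assumes "preserves_asymptotic_lines F" "preserves_asymptotic_lines G"
  shows "preserves_asymptotic_lines (G \<circ>\<^sub>m F)"
  unfolding preserves_asymptotic_lines_def
proof (intro allI impI)
  fix x y z assume xyz: "asymptotic_line x" "asymptotic_line y" "asymptotic_line z"
  obtain p q r where 1: "asymptotic_line p" "asymptotic_line q" "asymptotic_line r"
      and F: "finite {s. F (x s, y s, z s) \<noteq> Some (p s, q s, r s)}"
    using assms(1)[unfolded preserves_asymptotic_lines_def, rule_format, OF xyz] by blast
  obtain p' q' r' where 2: "asymptotic_line p'" "asymptotic_line q'" "asymptotic_line r'"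
      and G: "finite {s. G (p s, q s, r s) \<noteq> Some (p' s, q' s, r' s)}"
    using assms(2)[unfolded preserves_asymptotic_lines_def, rule_format, OF 1] by blast
  have "finite {s. (G \<circ>\<^sub>m F) (x s, y s, z s) \<noteq> Some (p' s, q' s, r' s)}"
    by (rule finite_subset[OF _ finite_UnI[OF F G]]) (auto simp: map_comp_def)
  with 2 show "\<exists>p q r. asymptotic_line p \<and> asymptotic_line q \<and> asymptotic_line r \<and>
        finite {s. (G \<circ>\<^sub>m F) (x s, y s, z s) \<noteq> Some (p s, q s, r s)}"
    by blast
qed

lemma preserves_asymptotic_lines_act:
  assumes "\<beta>1 \<noteq> 0" "\<beta>2 \<noteq> 0"
  shows "preserves_asymptotic_lines (act12 (yb_map \<epsilon> \<beta>1 \<beta>2))" (is "preserves_asymptotic_lines ?F12")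
    and "preserves_asymptotic_lines (act13 (yb_map \<epsilon> \<beta>1 \<beta>2))" (is "preserves_asymptotic_lines ?F13")
    and "preserves_asymptotic_lines (act23 (yb_map \<epsilon> \<beta>1 \<beta>2))" (is "preserves_asymptotic_lines ?F23")
proof -
  show "preserves_asymptotic_lines ?F12"
    unfolding preserves_asymptotic_lines_def
  proof (intro allI impI)
    fix x y z assume a: "asymptotic_line x" "asymptotic_line y" "asymptotic_line z"
    obtain p q where pq: "asymptotic_line p" "asymptotic_line q"
      and fin: "finite {s. yb_map \<epsilon> \<beta>1 \<beta>2 (x s, y s) \<noteq> Some (p s, q s)}"
      by (rule yb_map_asymptotic_line[OF \<open>asymptotic_line x\<close> \<open>asymptotic_line y\<close> assms])
    have "finite {s. ?F12 (x s, y s, z s) \<noteq> Some (p s, q s, z s)}"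
      by (rule finite_subset[OF _ fin]) (auto simp: act12_def simp del: map_option_eq_Some)
    with a pq show "\<exists>p q r. asymptotic_line p \<and> asymptotic_line q \<and> asymptotic_line r \<and>
        finite {s. ?F12 (x s, y s, z s) \<noteq> Some (p s, q s, r s)}"
      by - (rule exI[of _ p], rule exI[of _ q], rule exI[of _ z], simp)
  qed
  show "preserves_asymptotic_lines ?F13"
    unfolding preserves_asymptotic_lines_def
  proof (intro allI impI)
    fix x y z assume a: "asymptotic_line x" "asymptotic_line y" "asymptotic_line z"
    obtain p q where pq: "asymptotic_line p" "asymptotic_line q"
      and fin: "finite {s. yb_map \<epsilon> \<beta>1 \<beta>2 (x s, z s) \<noteq> Some (p s, q s)}"
      by (rule yb_map_asymptotic_line[OF \<open>asymptotic_line x\<close> \<open>asymptotic_line z\<close> assms])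
    have "finite {s. ?F13 (x s, y s, z s) \<noteq> Some (p s, y s, q s)}"
      by (rule finite_subset[OF _ fin]) (auto simp: act13_def simp del: map_option_eq_Some)
    with a pq show "\<exists>p q r. asymptotic_line p \<and> asymptotic_line q \<and> asymptotic_line r \<and>
        finite {s. ?F13 (x s, y s, z s) \<noteq> Some (p s, q s, r s)}"
      by - (rule exI[of _ p], rule exI[of _ y], rule exI[of _ q], simp)
  qed
  show "preserves_asymptotic_lines ?F23"
    unfolding preserves_asymptotic_lines_def
  proof (intro allI impI)
    fix x y z assume a: "asymptotic_line x" "asymptotic_line y" "asymptotic_line z"
    obtain p q where pq: "asymptotic_line p" "asymptotic_line q"
      and fin: "finite {s. yb_map \<epsilon> \<beta>1 \<beta>2 (y s, z s) \<noteq> Some (p s, q s)}"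
      by (rule yb_map_asymptotic_line[OF \<open>asymptotic_line y\<close> \<open>asymptotic_line z\<close> assms])
    have "finite {s. ?F23 (x s, y s, z s) \<noteq> Some (x s, p s, q s)}"
      by (rule finite_subset[OF _ fin]) (auto simp: act23_def simp del: map_option_eq_Some)
    with a pq show "\<exists>p q r. asymptotic_line p \<and> asymptotic_line q \<and> asymptotic_line r \<and>
        finite {s. ?F23 (x s, y s, z s) \<noteq> Some (p s, q s, r s)}"
      by - (rule exI[of _ x], rule exI[of _ p], rule exI[of _ q], simp)
  qed
qed

text \<open>
  The line through a given point in the direction \<open>((1, 0), (1, 0), (1, 0))\<close> meets the complement of the
  domains in finitely many points, while every neighbourhood of the point contains infinitely many
  points of the line.
\<close>

lemma dense_common_domain:
  assumes "preserves_asymptotic_lines F" "preserves_asymptotic_lines G"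
  shows "closure (dom F \<inter> dom G) = UNIV"
proof -
  have "t \<in> closure (dom F \<inter> dom G)" for t
  proof -
    obtain x1 x2 y1 y2 z1 z2 where t: "t = ((x1, x2), (y1, y2), (z1, z2))"
      by (metis surj_pair)
    define line where "line a s = (fst a + s, snd a)" for a :: c2 and s :: complex
    have line: "asymptotic_line (line a)" for a
      using linear_growth_line[of "fst a" 1] linear_growth_line[of "snd a" 0]
      by (simp add: asymptotic_line_def line_def)
    define \<gamma> where "\<gamma> s = (line (x1, x2) s, line (y1, y2) s, line (z1, z2) s)" for s
    have fin: "finite {s. \<gamma> s \<notin> dom H}" if H: "preserves_asymptotic_lines H" for H
    proof -
      obtain p q r where "finite {s. H (\<gamma> s) \<noteq> Some (p s, q s, r s)}"
        using H[unfolded preserves_asymptotic_lines_def, rule_format, OF line line line]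
        unfolding \<gamma>_def by blast
      then show ?thesis
        by (rule rev_finite_subset) (rule subsetI, simp add: domIff del: not_None_eq)
    qed
    have cont: "continuous_on UNIV \<gamma>"
      unfolding \<gamma>_def line_def by (intro continuous_intros)
    have "\<gamma> 0 = t"
      by (simp add: \<gamma>_def line_def t)
    have "(dom F \<inter> dom G) \<inter> S \<noteq> {}" if S: "open S" "t \<in> S" for S
    proof -
      have "open (\<gamma> -` S)" "\<gamma> -` S \<noteq> {}"
        using open_vimage[OF S(1) cont] S(2) \<open>\<gamma> 0 = t\<close> by auto
      then have "infinite (\<gamma> -` S)"
        using finite_imp_not_open by blast
      moreover have "finite ({s. \<gamma> s \<notin> dom F} \<union> {s. \<gamma> s \<notin> dom G})"
        using fin assms by blast
      ultimately have "\<not> \<gamma> -` S \<subseteq> {s. \<gamma> s \<notin> dom F} \<union> {s. \<gamma> s \<notin> dom G}"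
        using finite_subset by metis
      then obtain s where "\<gamma> s \<in> S" "\<gamma> s \<in> dom F" "\<gamma> s \<in> dom G"
        unfolding subset_iff Un_iff mem_Collect_eq vimage_eq by metis
      then show ?thesis
        by (metis IntI empty_iff)
    qed
    then show ?thesis
      by (auto simp: closure_iff_nhds_not_empty)
  qed
  then show ?thesis by auto
qed

theorem mainTheorem7:
  fixes \<epsilon> :: complex
  assumes "\<epsilon> \<noteq> 0"
  shows
    "(\<forall>\<beta>1 \<beta>2 u v u1 u2 v2 u12 v12 :: complex.
        \<beta>1 \<noteq> 0 \<longrightarrow> \<beta>2 \<noteq> 0 \<longrightarrow>
        \<beta>2 * (u + v2) + \<beta>1 * (u1 - u) \<noteq> 0 \<longrightarrow>
        \<beta>1 * (v + u1) + \<beta>2 * (v2 - v) \<noteq> 0 \<longrightarrow>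
        u12 = u + (1 / \<beta>1 - 1 / \<beta>2) *
          ((\<beta>1 * \<beta>2 * (u + v2) * (u1 - u) - \<epsilon>) / (\<beta>2 * (u + v2) + \<beta>1 * (u1 - u))) \<longrightarrow>
        v12 = v + (1 / \<beta>2 - 1 / \<beta>1) *
          ((\<beta>1 * \<beta>2 * (v + u1) * (v2 - v) - \<epsilon>) / (\<beta>1 * (v + u1) + \<beta>2 * (v2 - v))) \<longrightarrow>
        yb_map \<epsilon> \<beta>1 \<beta>2 ((u - u1, v + u1), (u2 - u, u + v2))
          = Some ((u2 - u12, v2 + u12), (u12 - u1, u1 + v12)))
     \<and>
     (\<forall>\<beta>1 \<beta>2 \<beta>3 :: complex.
        \<beta>1 \<noteq> 0 \<longrightarrow> \<beta>2 \<noteq> 0 \<longrightarrow> \<beta>3 \<noteq> 0 \<longrightarrow>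
        rational_map_eq
          (act23 (yb_map \<epsilon> \<beta>2 \<beta>3) \<circ>\<^sub>m act13 (yb_map \<epsilon> \<beta>1 \<beta>3) \<circ>\<^sub>m act12 (yb_map \<epsilon> \<beta>1 \<beta>2))
          (act12 (yb_map \<epsilon> \<beta>1 \<beta>2) \<circ>\<^sub>m act13 (yb_map \<epsilon> \<beta>1 \<beta>3) \<circ>\<^sub>m act23 (yb_map \<epsilon> \<beta>2 \<beta>3)))"
proof (intro conjI allI impI)
  fix \<beta>1 \<beta>2 u v u1 u2 v2 u12 v12 :: complex
  assume nz: "\<beta>1 \<noteq> 0" "\<beta>2 \<noteq> 0"
    and den: "\<beta>2 * (u + v2) + \<beta>1 * (u1 - u) \<noteq> 0" "\<beta>1 * (v + u1) + \<beta>2 * (v2 - v) \<noteq> 0"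
    and u12: "u12 = u + (1 / \<beta>1 - 1 / \<beta>2) *
      ((\<beta>1 * \<beta>2 * (u + v2) * (u1 - u) - \<epsilon>) / (\<beta>2 * (u + v2) + \<beta>1 * (u1 - u)))"
    and v12: "v12 = v + (1 / \<beta>2 - 1 / \<beta>1) *
      ((\<beta>1 * \<beta>2 * (v + u1) * (v2 - v) - \<epsilon>) / (\<beta>1 * (v + u1) + \<beta>2 * (v2 - v)))"
  have d: "\<beta>2 * (u + v2) - \<beta>1 * (u - u1) = \<beta>2 * (u + v2) + \<beta>1 * (u1 - u)"
    "u + v2 - (u - u1) - (v + u1) = v2 - v"
    by (simp_all add: algebra_simps)
  have P: "(1 / \<beta>1 - 1 / \<beta>2) * ((\<beta>1 * \<beta>2 * (u + v2) * (u - u1) + \<epsilon>) / (\<beta>2 * (u + v2) + \<beta>1 * (u1 - u)))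
      = u - u12"
  proof -
    have "\<beta>1 * \<beta>2 * (u + v2) * (u - u1) + \<epsilon> = - (\<beta>1 * \<beta>2 * (u + v2) * (u1 - u) - \<epsilon>)"
      by (simp add: algebra_simps)
    then show ?thesis
      unfolding u12 by (simp only: minus_divide_left[symmetric] mult_minus_right) simp
  qed
  show "yb_map \<epsilon> \<beta>1 \<beta>2 ((u - u1, v + u1), (u2 - u, u + v2))
      = Some ((u2 - u12, v2 + u12), (u12 - u1, u1 + v12))"
    unfolding yb_map_def prod.case Let_def d P using den by (simp add: v12)
next
  fix \<beta>1 \<beta>2 \<beta>3 :: complex
  assume nz: "\<beta>1 \<noteq> 0" "\<beta>2 \<noteq> 0" "\<beta>3 \<noteq> 0"
  let ?l = "act23 (yb_map \<epsilon> \<beta>2 \<beta>3) \<circ>\<^sub>m act13 (yb_map \<epsilon> \<beta>1 \<beta>3) \<circ>\<^sub>m act12 (yb_map \<epsilon> \<beta>1 \<beta>2)"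
  let ?r = "act12 (yb_map \<epsilon> \<beta>1 \<beta>2) \<circ>\<^sub>m act13 (yb_map \<epsilon> \<beta>1 \<beta>3) \<circ>\<^sub>m act23 (yb_map \<epsilon> \<beta>2 \<beta>3)"
  have "continuous_open_map ?l" "continuous_open_map ?r"
    by (intro continuous_open_map_comp continuous_open_map_act continuous_open_map_yb_map)+
  moreover have "closure (dom ?l \<inter> dom ?r) = UNIV"
    by (intro dense_common_domain preserves_asymptotic_lines_comp preserves_asymptotic_lines_act nz)
  ultimately show "rational_map_eq ?l ?r"
    using yang_baxter_on_common_domain[OF nz]
    unfolding rational_map_eq_def continuous_open_map_def by blast
qed

end
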